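(* In the group-sparsity setting described in the context, let $A:X\to\mathbf{R}^m$ be a linear map and $\phi(\cdot)$ a norm on $\mathbf{R}^m$. For all positive reals $s,\beta,\gamma$, the condition $$(\ast)\qquad \forall z\in X:\quad \|Bz\|_{1,s}\le\beta\phi(Az)+\gamma\|Bz\|$$ is sufficient for the validity of $\mathbf{C}^+_s(\gamma,\beta;\phi)$, and thus for the validity of $\mathbf{C}_s(\gamma,\beta;\phi)$. As a result, condition $(\ast)$ with $\gamma<1$ is sufficient for the following: (i) $A$ is $s$-good; (ii) (regular recovery) whenever $\epsilon,\delta_x,\delta_\phi,\delta\ge0$, $x,\widehat{x}\in X$, $y=Ax+\xi$ with $\phi(\xi)\le\epsilon$, there is $P\in\mathcal{P}_s$ with $\|Bx-PBx\|\le\delta_x$, $\phi(A\widehat{x}-y)\le\epsilon+\delta_\phi$, and $\|B\widehat{x}\|\le\min_{u\in X}\{\|Bu\|:\phi(Au-y)\le\epsilon\}+\delta$, one has $$\|B\widehat{x}-Bx\|\le\frac{\beta[2\epsilon+\delta_\phi]+\delta+2\delta_x}{1-\gamma};$$ (iii) (penalized recovery) whenever $\lambda\ge\beta$, $\delta_x,\delta\ge0$, $x,\widehat{x}\in X$, $y\in\mathbf{R}^m$, $\xi=y-Ax$, there is $P\in\mathcal{P}_s$ with $\|Bx-PBx\|\le\delta_x$, and $\lambda\phi(A\widehat{x}-y)+\|B\widehat{x}\|\le\min_{z\in X}\{\lambda\phi(Az-y)+\|Bz\|\}+\delta$, one has $$\|B\widehat{x}-Bx\|\le\frac{2\delta_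x+\delta+2\lambda\phi(\xi)}{1-\gamma}.$$
   Context: Group-sparsity setting. $X=\mathbf{R}^n$ with coordinates indexed by $V=\{1,\dots,n\}$; $V=V_1\cup\dots\cup V_K$ with nonempty, possibly overlapping subsets $V_\ell$; $\mathbf{R}(V_\ell)$ is the space of real vectors with entries indexed by $V_\ell$; for $x\in X$, $x^\ell\in\mathbf{R}(V_\ell)$ is the natural projection (restriction) of $x$ to the indices in $V_\ell$. Each $V_\ell$ is assigned a weight $\chi_\ell>0$ and each $\mathbf{R}(V_\ell)$ is equipped with a norm $\|\cdot\|_{(\ell)}$. $E=\mathbf{R}(V_1)\times\dots\times\mathbf{R}(V_K)$, with elements $w=[w^1;\dots;w^K]$, and $Bx=[x^1;\dots;x^K]$. The norm on $E$ is $\|w\|=\sum_{\ell=1}^K\|w^\ell\|_{(\ell)}$. The family $\mathcal{P}$ consists of the orthoprojectors $P_I$, $I\subseteq\{1,\dots,K\}$, of $E$ onto $E_I=\{w\in E: w^\ell=0\ \forall\ell\notin I\}$; $\overline{P_I}=\mathrm{Id}-P_I$ ($\mathrm{Id}$ the identity on $E$), and $\nu(P_I)=\sum_{\ell\in I}\chi_\ell$. $\mathcal{P}_s=\{P\in\mathcal{P}:\nu(P)\le s\}$. A vector $x\in X$ is $s$-sparse if there exists $P\in\mathcal{P}_s$ with $PBx=Bx$. $A$ is $s$-good if for every $s$-sparse $x\in X$, every $\widehat{x}\in\mathrm{Argmin}_{u\in X}\{\|Bu\|:Au=Ax\}$ satisfies $B\widehat{x}=Bx$. For $u\in\mathbf{R}^K$,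 $\pi_s(u)=2\max_\eta\{\sum_{\ell=1}^K\eta_\ell|u_\ell|:\eta_\ell\in\{0,1\}\ \forall\ell,\ \sum_{\ell=1}^K\chi_\ell\eta_\ell\le s\}$, and for $w\in E$, $\|w\|_{1,s}=\pi_s([\|w^1\|_{(1)};\dots;\|w^K\|_{(K)}])$. Condition $\mathbf{C}_s(\gamma,\beta;\phi)$: for all $z\in X$, $P\in\mathcal{P}_s$: $\|PBz\|+\|Bz\|-\|\overline{P}Bz\|\le\beta\phi(Az)+\gamma\|Bz\|$. Condition $\mathbf{C}^+_s(\gamma,\beta;\phi)$: there exists a (semi)norm $\|\cdot\|_{\mathcal{P}_s}$ on $E$ such that (a) for all $z\in X$, $P\in\mathcal{P}_s$: $\|PBz\|+\|Bz\|-\|\overline{P}Bz\|\le\|Bz\|_{\mathcal{P}_s}$; and (b) for all $z\in X$: $\|Bz\|_{\mathcal{P}_s}\le\beta\phi(Az)+\gamma\|Bz\|$. *)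

theory Defs
  imports "HOL-Analysis.Analysis"
begin

definition seminorm_on :: "'a::real_vector set \<Rightarrow> ('a \<Rightarrow> real) \<Rightarrow> bool" where
  "seminorm_on S p \<longleftrightarrow>
     (\<forall>x\<in>S. 0 \<le> p x) \<and>
     (\<forall>x\<in>S. \<forall>c. p (c *\<^sub>R x) = \<bar>c\<bar> * p x) \<and>
     (\<forall>x\<in>S. \<forall>y\<in>S. p (x + y) \<le> p x + p y)"

definition norm_on :: "'a::real_vector set \<Rightarrow> ('a \<Rightarrow> real) \<Rightarrow> bool" where
  "norm_on S p \<longleftrightarrow> seminorm_on S p \<and> (\<forall>x\<in>S. p x = 0 \<longrightarrow> x = 0)"

(* X = real^'n, and the groups are indexed by 'k, so that K = CARD('k).  The space R(J) of
   vectors with entries indexed by J is represented by the subspace of real^'n of vectors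
   vanishing outside J; norms on R(J) are only constrained on this subspace. *)

definition coord_space :: "'n set \<Rightarrow> (real^'n) set" where
  "coord_space J = {v. \<forall>i. i \<notin> J \<longrightarrow> v $ i = 0}"

definition restr :: "'n set \<Rightarrow> real^'n \<Rightarrow> real^'n" where
  "restr J x = (\<chi> i. if i \<in> J then x $ i else 0)"

definition group_space :: "('k \<Rightarrow> 'n set) \<Rightarrow> (real^'n^'k) set" where
  "group_space V = {w. \<forall>l. w $ l \<in> coord_space (V l)}"

definition group_map :: "('k \<Rightarrow> 'n set) \<Rightarrow> real^'n \<Rightarrow> real^'n^'k" where
  "group_map V x = (\<chi> l. restr (V l) x)"

definition group_norm :: "('k \<Rightarrow> real^'n \<Rightarrow> real) \<Rightarrow> real^'n^'k \<Rightarrow> real" where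
  "group_norm N w = (\<Sum>l\<in>UNIV. N l (w $ l))"

definition group_subspace :: "('k \<Rightarrow> 'n set) \<Rightarrow> 'k set \<Rightarrow> (real^'n^'k) set" where
  "group_subspace V I = {w \<in> group_space V. \<forall>l. l \<notin> I \<longrightarrow> w $ l = 0}"

(* Explicit form of P_I; group_proj_in_subspace and group_proj_orthogonal below characterize
   it as the orthogonal projector of group_space V onto group_subspace V I. *)
definition group_proj :: "'k set \<Rightarrow> real^'n^'k \<Rightarrow> real^'n^'k" where
  "group_proj I w = (\<chi> l. if l \<in> I then w $ l else 0)"

lemma group_proj_in_subspace:
  assumes "w \<in> group_space V"
  shows "group_proj I w \<in> group_subspace V I"
  using assms
  by (auto simp: group_proj_def group_subspace_def group_space_def coord_space_def)

lemma group_proj_orthogonal: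
  assumes "v \<in> group_subspace V I"
  shows "orthogonal (w - group_proj I w) v"
proof -
  have "(w - group_proj I w) $ l \<bullet> v $ l = 0" for l
    using assms by (cases "l \<in> I") (auto simp: group_proj_def group_subspace_def)
  then show ?thesis
    by (simp add: orthogonal_def inner_vec_def[of "w - group_proj I w"])
qed

definition nu :: "('k \<Rightarrow> real) \<Rightarrow> 'k set \<Rightarrow> real" where
  "nu wt I = (\<Sum>l\<in>I. wt l)"

definition sparse_projs :: "('k \<Rightarrow> real) \<Rightarrow> real \<Rightarrow> (real^'n^'k \<Rightarrow> real^'n^'k) set" where
  "sparse_projs wt s = {group_proj I | I. nu wt I \<le> s}"

definition s_sparse :: "('k::finite \<Rightarrow> 'n set) \<Rightarrow> ('k \<Rightarrow> real) \<Rightarrow> real \<Rightarrow> real^'n \<Rightarrow> bool" where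
  "s_sparse V wt s x \<longleftrightarrow> (\<exists>P\<in>sparse_projs wt s. P (group_map V x) = group_map V x)"

definition s_good ::
  "('k::finite \<Rightarrow> 'n set) \<Rightarrow> ('k \<Rightarrow> real) \<Rightarrow> ('k \<Rightarrow> real^'n \<Rightarrow> real) \<Rightarrow> real \<Rightarrow> (real^'n \<Rightarrow> real^'m) \<Rightarrow> bool"
where
  "s_good V wt N s A \<longleftrightarrow>
     (\<forall>x xh. s_sparse V wt s x \<longrightarrow>
        is_arg_min (\<lambda>u. group_norm N (group_map V u)) (\<lambda>u. A u = A x) xh \<longrightarrow>
        group_map V xh = group_map V x)"

definition pi_s :: "('k \<Rightarrow> real) \<Rightarrow> real \<Rightarrow> real^'k \<Rightarrow> real" where
  "pi_s wt s u =
     2 * Max {(\<Sum>l\<in>UNIV. \<eta> $ l * \<bar>u $ l\<bar>) | \<eta> :: real^'k.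
                (\<forall>l. \<eta> $ l \<in> {0, 1}) \<and> (\<Sum>l\<in>UNIV. wt l * \<eta> $ l) \<le> s}"

definition norm_1_s :: "('k \<Rightarrow> real) \<Rightarrow> ('k \<Rightarrow> real^'n \<Rightarrow> real) \<Rightarrow> real \<Rightarrow> real^'n^'k \<Rightarrow> real" where
  "norm_1_s wt N s w = pi_s wt s (\<chi> l. N l (w $ l))"

definition cond_C ::
  "('k::finite \<Rightarrow> 'n set) \<Rightarrow> ('k \<Rightarrow> real) \<Rightarrow> ('k \<Rightarrow> real^'n \<Rightarrow> real) \<Rightarrow> (real^'n \<Rightarrow> real^'m) \<Rightarrow>
   real \<Rightarrow> real \<Rightarrow> real \<Rightarrow> (real^'m \<Rightarrow> real) \<Rightarrow> bool"
where
  "cond_C V wt N A s \<gamma> \<beta> \<phi> \<longleftrightarrow>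
     (\<forall>z. \<forall>P\<in>sparse_projs wt s.
        group_norm N (P (group_map V z)) + group_norm N (group_map V z)
          - group_norm N (group_map V z - P (group_map V z))
        \<le> \<beta> * \<phi> (A z) + \<gamma> * group_norm N (group_map V z))"

definition cond_C_plus ::
  "('k::finite \<Rightarrow> 'n set) \<Rightarrow> ('k \<Rightarrow> real) \<Rightarrow> ('k \<Rightarrow> real^'n \<Rightarrow> real) \<Rightarrow> (real^'n \<Rightarrow> real^'m) \<Rightarrow>
   real \<Rightarrow> real \<Rightarrow> real \<Rightarrow> (real^'m \<Rightarrow> real) \<Rightarrow> bool"
where
  "cond_C_plus V wt N A s \<gamma> \<beta> \<phi> \<longleftrightarrow>
     (\<exists>p. seminorm_on (group_space V) p \<and>
        (\<forall>z. \<forall>P\<in>sparse_projs wt s.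
           group_norm N (P (group_map V z)) + group_norm N (group_map V z)
             - group_norm N (group_map V z - P (group_map V z))
           \<le> p (group_map V z)) \<and>
        (\<forall>z. p (group_map V z) \<le> \<beta> * \<phi> (A z) + \<gamma> * group_norm N (group_map V z)))"

end

theory Submission
  imports Defs
begin

text \<open>
  Since the norm on \<open>E\<close> is additive over the groups,
  \<open>\<parallel>P w\<parallel> + \<parallel>w\<parallel> - \<parallel>w - P w\<parallel> = 2 \<parallel>P w\<parallel>\<close> for every coordinate projector \<open>P\<close>. The maximum of
  the right-hand side over the \<open>s\<close>-admissible \<open>P\<close> is the seminorm \<open>\<parallel>w\<parallel>\<^bsub>1,s\<^esub>\<close>, which is
  therefore the witness for the condition C+. For the recovery bounds, splitting \<open>B xh\<close> and \<open>B x\<close>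
  by \<open>P\<close> and applying the triangle inequality to both parts gives, with \<open>h = xh - x\<close>,
  \<open>\<parallel>B h - P B h\<parallel> - \<parallel>P B h\<parallel> \<le> \<parallel>B xh\<parallel> - \<parallel>B x\<parallel> + 2 \<parallel>B x - P B x\<parallel>\<close>, and the condition C turns this
  into a bound on \<open>(1 - \<gamma>) \<parallel>B h\<parallel>\<close>.
\<close>

section \<open>Seminorms on subspaces\<close>

lemma seminorm_onD:
  assumes "seminorm_on S p"
  shows "x \<in> S \<Longrightarrow> 0 \<le> p x"
    and "x \<in> S \<Longrightarrow> p (c *\<^sub>R x) = \<bar>c\<bar> * p x"
    and "x \<in> S \<Longrightarrow> y \<in> S \<Longrightarrow> p (x + y) \<le> p x + p y"
  using assms by (auto simp: seminorm_on_def)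

lemma seminorm_on_uminus:
  assumes "seminorm_on S p" "x \<in> S"
  shows "p (- x) = p x"
  using seminorm_onD(2)[OF assms, of "-1"] by simp

lemma seminorm_on_zero:
  assumes "seminorm_on S p" "x \<in> S"
  shows "p 0 = 0"
  using seminorm_onD(2)[OF assms, of 0] by simp

text \<open>The identity \<open>q x = c * p x\<close> is asked for on \<open>S\<close> only, because
  formulas for norms built from the \<open>N l\<close> are available only on
  \<open>group_space V\<close>, where the \<open>N l\<close> are constrained.\<close>

lemma seminorm_on_scaled:
  assumes p: "seminorm_on S p" and S: "subspace S"
    and q: "\<And>x. x \<in> S \<Longrightarrow> q x = c * p x" and c: "0 \<le> c"
  shows "seminorm_on S q"
  unfolding seminorm_on_def
proof (intro conjI ballI allI)
  fix x y assume x: "x \<in> S" and y: "y \<in> S"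
  have "c * p (x + y) \<le> c * (p x + p y)"
    using seminorm_onD(3)[OF p x y] c by (rule mult_left_mono)
  then show "q (x + y) \<le> q x + q y"
    by (simp add: q x y subspace_add[OF S] distrib_left)
qed (simp_all add: q c subspace_scale[OF S] seminorm_onD(1,2)[OF p] mult.left_commute)

lemma seminorm_on_diff_le:
  assumes "seminorm_on S p" "subspace S" "x \<in> S" "y \<in> S"
  shows "p (x - y) \<le> p x + p y"
  using seminorm_onD(3)[OF assms(1,3), of "- y"] seminorm_on_uminus[OF assms(1,4)]
    subspace_neg[OF assms(2,4)] by simp

section \<open>The product space, its coordinate projectors and its norm\<close>

lemma subspace_coord_space: "subspace (coord_space J)"
  by (auto simp: subspace_def coord_space_def)

lemma subspace_group_space: "subspace (group_space V)"
  by (auto simp: subspace_def group_space_def coord_space_def)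

lemma group_map_in_group_space: "group_map V x \<in> group_space V"
  by (auto simp: group_map_def group_space_def coord_space_def restr_def)

lemma group_map_diff: "group_map V (x - y) = group_map V x - group_map V y"
  by (auto simp: group_map_def restr_def vec_eq_iff)

lemma group_proj_in_group_space:
  "w \<in> group_space V \<Longrightarrow> group_proj I w \<in> group_space V"
  by (auto simp: group_proj_def group_space_def coord_space_def)

lemma group_proj_diff: "group_proj I (v - w) = group_proj I v - group_proj I w"
  by (auto simp: group_proj_def vec_eq_iff)

lemma norm_on_imp_seminorm_on: "norm_on S p \<Longrightarrow> seminorm_on S p"
  by (simp add: norm_on_def)

text \<open>An arbitrary index set serves two purposes: \<open>UNIV\<close> gives the group norm,
  and a smaller \<open>I\<close> gives the norm of a projection.\<close>

lemma seminorm_on_sum_component: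
  fixes V :: "'k::finite \<Rightarrow> 'n::finite set"
  assumes "\<And>l. seminorm_on (coord_space (V l)) (N l)"
  shows "seminorm_on (group_space V) (\<lambda>w. \<Sum>l\<in>I. N l (w $ l))"
  using assms unfolding seminorm_on_def group_space_def
  by (auto intro!: sum_nonneg sum_mono simp: sum_distrib_left simp flip: sum.distrib)

lemma seminorm_on_group_norm:
  fixes V :: "'k::finite \<Rightarrow> 'n::finite set"
  assumes "\<And>l. seminorm_on (coord_space (V l)) (N l)"
  shows "seminorm_on (group_space V) (group_norm N)"
  using seminorm_on_sum_component[OF assms, where I = UNIV] by (simp add: group_norm_def[abs_def])

text \<open>A vanishing sum of nonnegative terms has only zero terms, so definiteness passes from
  the groups to the sum. This is what turns a zero error norm into the equality required by
  \<open>s_good\<close>.\<close>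

lemma norm_on_group_norm:
  fixes V :: "'k::finite \<Rightarrow> 'n::finite set"
  assumes "\<And>l. norm_on (coord_space (V l)) (N l)"
  shows "norm_on (group_space V) (group_norm N)"
  unfolding norm_on_def
proof (intro conjI ballI impI)
  show "seminorm_on (group_space V) (group_norm N)"
    using assms by (intro seminorm_on_group_norm norm_on_imp_seminorm_on)
  fix w assume w: "w \<in> group_space V" and "group_norm N w = 0"
  moreover have "0 \<le> N l (w $ l)" for l
    using w assms[of l] by (auto simp: group_space_def norm_on_def seminorm_on_def)
  ultimately have "N l (w $ l) = 0" for l
    by (simp add: group_norm_def sum_nonneg_eq_0_iff)
  then have "w $ l = 0" for l
    using w assms[of l] by (auto simp: group_space_def norm_on_def)
  then show "w = 0"
    by (simp add: vec_eq_iff)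
qed

lemma group_norm_proj:
  fixes V :: "'k::finite \<Rightarrow> 'n::finite set"
  assumes "\<And>l. seminorm_on (coord_space (V l)) (N l)" "w \<in> group_space V"
  shows "group_norm N (group_proj I w) = (\<Sum>l\<in>I. N l (w $ l))"
    and "group_norm N (w - group_proj I w) = (\<Sum>l\<in>-I. N l (w $ l))"
proof -
  have N0: "N l 0 = 0" for l
    using seminorm_on_zero[OF assms(1) subspace_0[OF subspace_coord_space]] .
  have "group_norm N (group_proj I w) = (\<Sum>l\<in>UNIV. if l \<in> I then N l (w $ l) else 0)"
    unfolding group_norm_def by (intro sum.cong) (auto simp: group_proj_def N0)
  then show "group_norm N (group_proj I w) = (\<Sum>l\<in>I. N l (w $ l))"
    by (simp flip: sum.inter_restrict)
  have "group_norm N (w - group_proj I w) = (\<Sum>l\<in>UNIV. if l \<in> -I then N l (w $ l) else 0)"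
    unfolding group_norm_def by (intro sum.cong) (auto simp: group_proj_def N0)
  then show "group_norm N (w - group_proj I w) = (\<Sum>l\<in>-I. N l (w $ l))"
    by (simp flip: sum.inter_restrict del: Compl_iff)
qed

text \<open>\<open>I\<close> and its complement partition the groups, and the norm is a plain sum
  over groups, so the triangle inequality for this decomposition is an equality.\<close>

lemma group_norm_split:
  fixes V :: "'k::finite \<Rightarrow> 'n::finite set"
  assumes "\<And>l. seminorm_on (coord_space (V l)) (N l)" "w \<in> group_space V"
  shows "group_norm N w = group_norm N (group_proj I w) + group_norm N (w - group_proj I w)"
  unfolding group_norm_proj[OF assms]
  using sum.union_disjoint[of I "-I" "\<lambda>l. N l (w $ l)"]
  by (simp add: group_norm_def Compl_partition)

section \<open>The seminorm \<open>norm_1_s\<close> as a maximum over admissible projectors\<close>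

text \<open>A 0/1 vector is the indicator of a set of groups. Passing to sets gives a maximum over a
  finite family, with the same index sets as \<open>sparse_projs\<close>.\<close>

lemma pi_s_eq_Max_sets:
  fixes wt :: "'k::finite \<Rightarrow> real"
  shows "pi_s wt s u = 2 * (MAX I\<in>{I. nu wt I \<le> s}. \<Sum>l\<in>I. \<bar>u $ l\<bar>)"
proof -
  let ?chi = "\<lambda>I. (\<chi> l. if l \<in> I then 1 else 0) :: real^'k"
  have sum_chi: "(\<Sum>l\<in>UNIV. ?chi I $ l * f l) = sum f I" for I and f :: "'k \<Rightarrow> real"
    by (simp add: if_distrib[of "\<lambda>c. c * _"] flip: sum.inter_restrict cong: if_cong)
  have sum_chi': "(\<Sum>l\<in>UNIV. wt l * ?chi I $ l) = nu wt I" for I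
    using sum_chi[of I wt] by (simp add: nu_def mult.commute)
  \<comment> \<open>The set is recovered from the vector as its level set at 1.\<close>
  have chi: "\<eta> = ?chi {l. \<eta> $ l = 1}" if "\<forall>l. \<eta> $ l \<in> {0, 1}" for \<eta> :: "real^'k"
    using that by (auto simp: vec_eq_iff)
  have "{(\<Sum>l\<in>UNIV. \<eta> $ l * \<bar>u $ l\<bar>) | \<eta> :: real^'k.
                (\<forall>l. \<eta> $ l \<in> {0, 1}) \<and> (\<Sum>l\<in>UNIV. wt l * \<eta> $ l) \<le> s}
        = (\<lambda>I. \<Sum>l\<in>I. \<bar>u $ l\<bar>) ` {I. nu wt I \<le> s}" (is "?L = ?R")
  proof
    show "?L \<subseteq> ?R"
    proof
      fix a assume "a \<in> ?L"
      then obtain \<eta> :: "real^'k" where \<eta>: "\<forall>l. \<eta> $ l \<in> {0, 1}"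
        "(\<Sum>l\<in>UNIV. wt l * \<eta> $ l) \<le> s" "a = (\<Sum>l\<in>UNIV. \<eta> $ l * \<bar>u $ l\<bar>)"
        by blast
      obtain I where "\<eta> = ?chi I"
        using chi[OF \<eta>(1)] by blast
      then have "nu wt I \<le> s" "a = (\<Sum>l\<in>I. \<bar>u $ l\<bar>)"
        using \<eta>(2,3) by (simp_all only: sum_chi sum_chi')
      then show "a \<in> ?R"
        by blast
    qed
    show "?R \<subseteq> ?L"
    proof
      fix a assume "a \<in> ?R"
      then obtain I where "nu wt I \<le> s" "a = (\<Sum>l\<in>I. \<bar>u $ l\<bar>)"
        by blast
      then have "a = (\<Sum>l\<in>UNIV. ?chi I $ l * \<bar>u $ l\<bar>)" "(\<Sum>l\<in>UNIV. wt l * ?chi I $ l) \<le> s"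
        by (simp_all only: sum_chi sum_chi')
      moreover have "\<forall>l. ?chi I $ l \<in> {0, 1}"
        by simp
      ultimately show "a \<in> ?L"
        by blast
    qed
  qed
  then show ?thesis
    by (simp add: pi_s_def)
qed

text \<open>Each \<open>N l\<close> is nonnegative on its coordinate space, so every sum in the
  maximum is the norm of a projection of \<open>w\<close>.\<close>

lemma norm_1_s_eq_Max_proj:
  fixes V :: "'k::finite \<Rightarrow> 'n::finite set"
  assumes "\<And>l. seminorm_on (coord_space (V l)) (N l)" "w \<in> group_space V"
  shows "norm_1_s wt N s w = 2 * (MAX I\<in>{I. nu wt I \<le> s}. group_norm N (group_proj I w))"
proof -
  have "\<bar>N l (w $ l)\<bar> = N l (w $ l)" for l
    using assms(2) seminorm_onD(1)[OF assms(1)] by (simp add: group_space_def)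
  then show ?thesis
    by (simp add: norm_1_s_def pi_s_eq_Max_sets group_norm_proj[OF assms])
qed

lemma seminorm_on_Max:
  assumes "finite F" "F \<noteq> {}" "\<And>i. i \<in> F \<Longrightarrow> seminorm_on S (p i)"
  shows "seminorm_on S (\<lambda>x. MAX i\<in>F. p i x)"
  unfolding seminorm_on_def
proof (intro conjI ballI allI)
  fix x assume x: "x \<in> S"
  obtain i where "i \<in> F"
    using assms(2) by blast
  then have "0 \<le> p i x" "p i x \<le> (MAX i\<in>F. p i x)"
    using x assms(1) seminorm_onD(1)[OF assms(3)] by auto
  then show "0 \<le> (MAX i\<in>F. p i x)"
    by linarith
  fix c
  have "(\<lambda>i. p i (c *\<^sub>R x)) ` F = (\<lambda>i. \<bar>c\<bar> * p i x) ` F"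
    using x seminorm_onD(2)[OF assms(3)] by (intro image_cong) auto
  \<comment> \<open>Multiplication by a nonnegative factor is monotone and thus commutes with the
    maximum of a finite nonempty set.\<close>
  also have "Max \<dots> = \<bar>c\<bar> * (MAX i\<in>F. p i x)"
    using mono_Max_commute[of "(*) \<bar>c\<bar>" "(\<lambda>i. p i x) ` F"] assms(1,2)
    by (simp add: mono_def mult_left_mono image_image)
  finally show "(MAX i\<in>F. p i (c *\<^sub>R x)) = \<bar>c\<bar> * (MAX i\<in>F. p i x)" .
next
  fix x y assume "x \<in> S" "y \<in> S"
  \<comment> \<open>The bound does not depend on \<open>i\<close>, so it passes to the
    maximum.\<close>
  then have "p i (x + y) \<le> (MAX i\<in>F. p i x) + (MAX i\<in>F. p i y)" if "i \<in> F" for i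
    using that assms(1) by (intro order_trans[OF seminorm_onD(3)[OF assms(3)]] add_mono) auto
  then show "(MAX i\<in>F. p i (x + y)) \<le> (MAX i\<in>F. p i x) + (MAX i\<in>F. p i y)"
    using assms(1,2) by simp
qed

lemma seminorm_on_norm_1_s:
  fixes V :: "'k::finite \<Rightarrow> 'n::finite set"
  assumes "\<And>l. seminorm_on (coord_space (V l)) (N l)" "0 \<le> s"
  shows "seminorm_on (group_space V) (norm_1_s wt N s)"
proof -
  \<comment> \<open>The empty set has weight 0 and is admissible since
    \<open>0 \<le> s\<close>.\<close>
  have "{I. nu wt I \<le> s} \<noteq> {}"
    using assms(2) by (auto simp: nu_def intro!: exI[of _ "{}"])
  then have "seminorm_on (group_space V) (\<lambda>w. MAX I\<in>{I. nu wt I \<le> s}. \<Sum>l\<in>I. N l (w $ l))"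
    by (intro seminorm_on_Max seminorm_on_sum_component assms(1)) auto
  then show ?thesis
    by (rule seminorm_on_scaled[OF _ subspace_group_space, where c = 2])
      (simp_all add: norm_1_s_eq_Max_proj[where V = V and N = N, OF assms(1)]
        group_norm_proj[where V = V and N = N, OF assms(1)])
qed

text \<open>This is the first inequality demanded of the seminorm in \<open>cond_C_plus\<close>: the
  excess is twice one of the candidates in the maximum.\<close>

lemma proj_excess_le_norm_1_s:
  fixes V :: "'k::finite \<Rightarrow> 'n::finite set"
  assumes N: "\<And>l. seminorm_on (coord_space (V l)) (N l)" and w: "w \<in> group_space V"
    and P: "P \<in> sparse_projs wt s"
  shows "group_norm N (P w) + group_norm N w - group_norm N (w - P w) \<le> norm_1_s wt N s w"
proof -
  obtain I where I: "P = group_proj I" "nu wt I \<le> s"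
    using P by (auto simp: sparse_projs_def)
  have "group_norm N (P w) + group_norm N w - group_norm N (w - P w)
      = 2 * group_norm N (group_proj I w)"
    using group_norm_split[where V = V and N = N, OF N w, of I] by (simp add: I)
  also have "\<dots> \<le> norm_1_s wt N s w"
    using I(2) by (auto simp: norm_1_s_eq_Max_proj[where V = V and N = N, OF N w] intro!: Max_ge)
  finally show ?thesis .
qed

section \<open>The error bound implied by condition C\<close>

lemma cond_C_plus_imp_cond_C:
  "cond_C_plus V wt N A s \<gamma> \<beta> \<phi> \<Longrightarrow> cond_C V wt N A s \<gamma> \<beta> \<phi>"
  unfolding cond_C_plus_def cond_C_def by (meson order_trans)

text \<open>The common source of goodness and of both recovery bounds, which differ only in how they
  estimate the right-hand side.\<close>

lemma cond_C_error_bound: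
  fixes V :: "'k::finite \<Rightarrow> 'n::finite set"
  assumes N: "\<And>l. seminorm_on (coord_space (V l)) (N l)"
    and C: "cond_C V wt N A s \<gamma> \<beta> \<phi>" and P: "P \<in> sparse_projs wt s"
  shows "(1 - \<gamma>) * group_norm N (group_map V xh - group_map V x)
    \<le> \<beta> * \<phi> (A (xh - x)) + 2 * group_norm N (group_map V x - P (group_map V x))
      + group_norm N (group_map V xh) - group_norm N (group_map V x)"
proof -
  obtain I where I: "P = group_proj I"
    using P by (auto simp: sparse_projs_def)
  define u v h where "u = group_map V xh" "v = group_map V x" "h = u - v"
  have uv: "u \<in> group_space V" "v \<in> group_space V" "h \<in> group_space V"
    by (auto simp: u_v_h_def group_map_in_group_space subspace_diff[OF subspace_group_space])
  note sn = seminorm_on_group_norm[where V = V and N = N, OF N] subspace_group_space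
  have mem: "P w \<in> group_space V" "w - P w \<in> group_space V" if "w \<in> group_space V" for w
    using that by (auto simp: I group_proj_in_group_space subspace_diff[OF subspace_group_space])
  have Ph: "P h = P u - P v"
    by (simp add: I u_v_h_def group_proj_diff)
  then have h_split: "h - P h = (u - P u) - (v - P v)"
    by (simp add: u_v_h_def)
  \<comment> \<open>On the range of \<open>P\<close> the true signal is bounded through
    \<open>P v = P u - P h\<close>; on the complement, next, the error is bounded instead. Adding
    both bounds and the splittings of \<open>u\<close> and \<open>v\<close> compares the two
    norms.\<close>
  have "group_norm N (P v) \<le> group_norm N (P u) + group_norm N (P h)"
    using seminorm_on_diff_le[OF sn, where x = "P u" and y = "P h"] mem(1)[OF uv(1)] mem(1)[OF uv(3)]
    by (simp add: Ph)
  moreover have "group_norm N (h - P h) \<le> group_norm N (u - P u) + group_norm N (v - P v)"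
    using seminorm_on_diff_le[OF sn, where x = "u - P u" and y = "v - P v"] mem(2) uv
    by (simp add: h_split)
  \<comment> \<open>Condition C at \<open>z = xh - x\<close>.\<close>
  moreover have "group_norm N (P h) + group_norm N h - group_norm N (h - P h)
      \<le> \<beta> * \<phi> (A (xh - x)) + \<gamma> * group_norm N h"
    using C P unfolding cond_C_def u_v_h_def by (metis group_map_diff)
  moreover have "group_norm N u = group_norm N (P u) + group_norm N (u - P u)"
    "group_norm N v = group_norm N (P v) + group_norm N (v - P v)"
    using group_norm_split[where V = V and N = N, OF N] uv by (auto simp: I)
  moreover have "(1 - \<gamma>) * group_norm N h = group_norm N h - \<gamma> * group_norm N h"
    by (simp add: algebra_simps)
  ultimately show ?thesis
    unfolding u_v_h_def by linarith
qed

section \<open>Goodness and the two recovery bounds\<close>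

text \<open>For a sparse \<open>x\<close> and a minimizer \<open>xh\<close>, the residual
  \<open>A (xh - x)\<close> and the tail of \<open>x\<close> vanish and the norm does not increase,
  so the right-hand side of the error bound is at most 0.\<close>

lemma cond_C_imp_s_good:
  fixes V :: "'k::finite \<Rightarrow> 'n::finite set" and A :: "real^'n \<Rightarrow> real^'m::finite"
  assumes N: "\<And>l. norm_on (coord_space (V l)) (N l)"
    and A: "linear A" and \<phi>: "norm_on UNIV \<phi>"
    and C: "cond_C V wt N A s \<gamma> \<beta> \<phi>" and \<gamma>: "\<gamma> < 1"
  shows "s_good V wt N s A"
  unfolding s_good_def
proof (intro allI impI)
  fix x xh
  assume "s_sparse V wt s x"
    and min: "is_arg_min (\<lambda>u. group_norm N (group_map V u)) (\<lambda>u. A u = A x) xh"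
  then obtain P where P: "P \<in> sparse_projs wt s" "P (group_map V x) = group_map V x"
    by (auto simp: s_sparse_def)
  note sn = norm_on_imp_seminorm_on[OF N] and gn = norm_on_group_norm[where V = V and N = N, OF N]
  let ?d = "group_map V xh - group_map V x"
  have d: "?d \<in> group_space V"
    by (intro subspace_diff subspace_group_space group_map_in_group_space)
  \<comment> \<open>\<open>x\<close> itself is a competitor in the minimization.\<close>
  have "A (xh - x) = 0" "group_norm N (group_map V xh) \<le> group_norm N (group_map V x)"
    using min by (auto simp: is_arg_min_linorder linear_diff[OF A])
  moreover have "\<phi> 0 = 0"
    using seminorm_on_zero[OF norm_on_imp_seminorm_on[OF \<phi>]] by simp
  moreover have "group_norm N 0 = 0"
    using seminorm_on_zero[OF norm_on_imp_seminorm_on[OF gn] d] .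
  ultimately have "(1 - \<gamma>) * group_norm N ?d \<le> 0"
    using cond_C_error_bound[OF sn C P(1), of xh x] by (simp add: P(2))
  then have "group_norm N ?d \<le> 0"
    using \<gamma> by (simp add: mult_le_0_iff)
  moreover have "0 \<le> group_norm N ?d"
    using seminorm_onD(1)[OF norm_on_imp_seminorm_on[OF gn] d] .
  ultimately have "?d = 0"
    using gn d unfolding norm_on_def by (meson order_antisym)
  then show "group_map V xh = group_map V x"
    by simp
qed

text \<open>The noise bound makes \<open>x\<close> feasible, so \<open>xh\<close> exceeds its norm
  by at most \<open>\<delta>\<close>. The residuals of \<open>xh\<close> and \<open>x\<close>
  together contribute \<open>2 * \<epsilon> + \<delta>\<phi>\<close>.\<close>

lemma cond_C_regular_recovery:
  fixes V :: "'k::finite \<Rightarrow> 'n::finite set" and A :: "real^'n \<Rightarrow> real^'m::finite"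
  assumes N: "\<And>l. seminorm_on (coord_space (V l)) (N l)"
    and A: "linear A" and \<phi>: "seminorm_on UNIV \<phi>"
    and C: "cond_C V wt N A s \<gamma> \<beta> \<phi>" and \<gamma>: "\<gamma> < 1" and \<beta>: "0 \<le> \<beta>"
    and y: "y = A x + \<xi>" "\<phi> \<xi> \<le> \<epsilon>"
    and P: "P \<in> sparse_projs wt s" "group_norm N (group_map V x - P (group_map V x)) \<le> \<delta>x"
    and feas: "\<phi> (A xh - y) \<le> \<epsilon> + \<delta>\<phi>"
    and opt: "group_norm N (group_map V xh)
      \<le> (INF u\<in>{u. \<phi> (A u - y) \<le> \<epsilon>}. group_norm N (group_map V u)) + \<delta>"
  shows "group_norm N (group_map V xh - group_map V x)
    \<le> (\<beta> * (2 * \<epsilon> + \<delta>\<phi>) + \<delta> + 2 * \<delta>x) / (1 - \<gamma>)"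
proof -
  have pos: "0 \<le> group_norm N (group_map V u)" for u
    using seminorm_onD(1)[OF seminorm_on_group_norm[where V = V and N = N, OF N] group_map_in_group_space] .
  have "\<phi> (A x - y) \<le> \<epsilon>"
    using y seminorm_on_uminus[OF \<phi>, of \<xi>] by simp
  \<comment> \<open>The infimum over a set of reals is a lower bound because the norms are bounded
    below by 0.\<close>
  then have "(INF u\<in>{u. \<phi> (A u - y) \<le> \<epsilon>}. group_norm N (group_map V u))
      \<le> group_norm N (group_map V x)"
    using pos by (intro cINF_lower bdd_belowI[of _ 0]) auto
  moreover have "\<phi> (A (xh - x)) \<le> \<phi> (A xh - y) + \<phi> \<xi>"
    using seminorm_onD(3)[OF \<phi>, of "A xh - y" \<xi>] by (simp add: y linear_diff[OF A])
  then have "\<beta> * \<phi> (A (xh - x)) \<le> \<beta> * (2 * \<epsilon> + \<delta>\<phi>)"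
    using feas y(2) by (intro mult_left_mono[OF _ \<beta>]) linarith
  ultimately have "(1 - \<gamma>) * group_norm N (group_map V xh - group_map V x)
      \<le> \<beta> * (2 * \<epsilon> + \<delta>\<phi>) + \<delta> + 2 * \<delta>x"
    using cond_C_error_bound[where V = V and N = N, OF N C P(1), of xh x] P(2) opt by linarith
  then show ?thesis
    using \<gamma> by (simp add: pos_le_divide_eq mult.commute)
qed

text \<open>Since \<open>\<beta> \<le> lam\<close>, the penalty paid by \<open>xh\<close> absorbs
  its residual in the error bound. One \<open>lam * \<phi> (y - A x)\<close> comes from the triangle
  inequality, the other from the penalty of the competitor \<open>x\<close>.\<close>

lemma cond_C_penalized_recovery:
  fixes V :: "'k::finite \<Rightarrow> 'n::finite set" and A :: "real^'n \<Rightarrow> real^'m::finite"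
  assumes N: "\<And>l. seminorm_on (coord_space (V l)) (N l)"
    and A: "linear A" and \<phi>: "seminorm_on UNIV \<phi>"
    and C: "cond_C V wt N A s \<gamma> \<beta> \<phi>" and \<gamma>: "\<gamma> < 1" and \<beta>: "0 \<le> \<beta>" "\<beta> \<le> lam"
    and P: "P \<in> sparse_projs wt s" "group_norm N (group_map V x - P (group_map V x)) \<le> \<delta>x"
    and opt: "lam * \<phi> (A xh - y) + group_norm N (group_map V xh)
      \<le> (INF z. lam * \<phi> (A z - y) + group_norm N (group_map V z)) + \<delta>"
  shows "group_norm N (group_map V xh - group_map V x)
    \<le> (2 * \<delta>x + \<delta> + 2 * lam * \<phi> (y - A x)) / (1 - \<gamma>)"
proof -
  have pos: "0 \<le> group_norm N (group_map V u)" for u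
    using seminorm_onD(1)[OF seminorm_on_group_norm[where V = V and N = N, OF N] group_map_in_group_space] .
  have pos': "0 \<le> \<phi> v" for v
    using seminorm_onD(1)[OF \<phi>] by simp
  have sym: "\<phi> (A x - y) = \<phi> (y - A x)"
    using seminorm_on_uminus[OF \<phi>, of "y - A x"] by simp
  have "(INF z. lam * \<phi> (A z - y) + group_norm N (group_map V z))
      \<le> lam * \<phi> (A x - y) + group_norm N (group_map V x)"
    using pos pos' \<beta> by (intro cINF_lower bdd_belowI[of _ 0]) auto
  \<comment> \<open>The first summand cancels against the penalty term in
    \<open>opt\<close>.\<close>
  moreover have "\<beta> * \<phi> (A (xh - x)) \<le> lam * (\<phi> (A xh - y) + \<phi> (y - A x))"
    using seminorm_onD(3)[OF \<phi>, of "A xh - y" "y - A x"] \<beta> pos'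
    by (intro mult_mono) (simp_all add: linear_diff[OF A])
  ultimately have "(1 - \<gamma>) * group_norm N (group_map V xh - group_map V x)
      \<le> 2 * \<delta>x + \<delta> + 2 * lam * \<phi> (y - A x)"
    using cond_C_error_bound[where V = V and N = N, OF N C P(1), of xh x] P(2) opt by (simp add: sym distrib_left)
  then show ?thesis
    using \<gamma> by (simp add: pos_le_divide_eq mult.commute)
qed

theorem proposition4p1:
  fixes V :: "'k::finite \<Rightarrow> 'n::finite set"
    and wt :: "'k \<Rightarrow> real"
    and N :: "'k \<Rightarrow> real^'n \<Rightarrow> real"
    and A :: "real^'n \<Rightarrow> real^'m::finite"
    and \<phi> :: "real^'m \<Rightarrow> real"
    and s \<beta> \<gamma> :: real
  assumes "\<And>l. V l \<noteq> {}"
    and "(\<Union>l. V l) = UNIV"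
    and "\<And>l. wt l > 0"
    and "\<And>l. norm_on (coord_space (V l)) (N l)"
    and "linear A"
    and "norm_on UNIV \<phi>"
    and "s > 0" and "\<beta> > 0" and "\<gamma> > 0"
    and star: "\<And>z. norm_1_s wt N s (group_map V z)
                 \<le> \<beta> * \<phi> (A z) + \<gamma> * group_norm N (group_map V z)"
  shows "cond_C_plus V wt N A s \<gamma> \<beta> \<phi> \<and>
    cond_C V wt N A s \<gamma> \<beta> \<phi> \<and>
    (\<gamma> < 1 \<longrightarrow>
       s_good V wt N s A \<and>
       (\<forall>\<epsilon> \<delta>x \<delta>\<phi> \<delta> x xh y \<xi>.
          \<epsilon> \<ge> 0 \<longrightarrow> \<delta>x \<ge> 0 \<longrightarrow> \<delta>\<phi> \<ge> 0 \<longrightarrow> \<delta> \<ge> 0 \<longrightarrow>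
          y = A x + \<xi> \<longrightarrow> \<phi> \<xi> \<le> \<epsilon> \<longrightarrow>
          (\<exists>P\<in>sparse_projs wt s. group_norm N (group_map V x - P (group_map V x)) \<le> \<delta>x) \<longrightarrow>
          \<phi> (A xh - y) \<le> \<epsilon> + \<delta>\<phi> \<longrightarrow>
          group_norm N (group_map V xh)
            \<le> (INF u\<in>{u. \<phi> (A u - y) \<le> \<epsilon>}. group_norm N (group_map V u)) + \<delta> \<longrightarrow>
          group_norm N (group_map V xh - group_map V x)
            \<le> (\<beta> * (2 * \<epsilon> + \<delta>\<phi>) + \<delta> + 2 * \<delta>x) / (1 - \<gamma>)) \<and>
       (\<forall>lam \<delta>x \<delta> x xh y \<xi>.
          lam \<ge> \<beta> \<longrightarrow> \<delta>x \<ge> 0 \<longrightarrow> \<delta> \<ge> 0 \<longrightarrow>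
          \<xi> = y - A x \<longrightarrow>
          (\<exists>P\<in>sparse_projs wt s. group_norm N (group_map V x - P (group_map V x)) \<le> \<delta>x) \<longrightarrow>
          lam * \<phi> (A xh - y) + group_norm N (group_map V xh)
            \<le> (INF z. lam * \<phi> (A z - y) + group_norm N (group_map V z)) + \<delta> \<longrightarrow>
          group_norm N (group_map V xh - group_map V x)
            \<le> (2 * \<delta>x + \<delta> + 2 * lam * \<phi> \<xi>) / (1 - \<gamma>)))"
proof -
  have N: "seminorm_on (coord_space (V l)) (N l)" for l
    by (rule norm_on_imp_seminorm_on[OF assms(4)])
  note \<phi> = norm_on_imp_seminorm_on[OF \<open>norm_on UNIV \<phi>\<close>]
  have plus: "cond_C_plus V wt N A s \<gamma> \<beta> \<phi>"
    unfolding cond_C_plus_def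
    using seminorm_on_norm_1_s[where V = V and N = N and wt = wt, OF N less_imp_le[OF \<open>s > 0\<close>]] star
      proj_excess_le_norm_1_s[where V = V and N = N, OF N group_map_in_group_space]
    by (intro exI[of _ "norm_1_s wt N s"] conjI allI ballI) auto
  have C: "cond_C V wt N A s \<gamma> \<beta> \<phi>"
    by (rule cond_C_plus_imp_cond_C[OF plus])
  note \<beta> = less_imp_le[OF \<open>\<beta> > 0\<close>]
  show ?thesis
  proof (intro conjI plus C impI allI)
    assume \<gamma>: "\<gamma> < 1"
    show "s_good V wt N s A"
      by (rule cond_C_imp_s_good[OF assms(4) \<open>linear A\<close> \<open>norm_on UNIV \<phi>\<close> C \<gamma>])
  next
    fix \<epsilon> \<delta>x \<delta>\<phi> \<delta> x xh y \<xi>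
    assume "\<gamma> < 1" "y = A x + \<xi>" "\<phi> \<xi> \<le> \<epsilon>" "\<phi> (A xh - y) \<le> \<epsilon> + \<delta>\<phi>"
      "\<exists>P\<in>sparse_projs wt s. group_norm N (group_map V x - P (group_map V x)) \<le> \<delta>x"
      "group_norm N (group_map V xh)
        \<le> (INF u\<in>{u. \<phi> (A u - y) \<le> \<epsilon>}. group_norm N (group_map V u)) + \<delta>"
    then show "group_norm N (group_map V xh - group_map V x)
        \<le> (\<beta> * (2 * \<epsilon> + \<delta>\<phi>) + \<delta> + 2 * \<delta>x) / (1 - \<gamma>)"
      using cond_C_regular_recovery[where V = V and N = N, OF N \<open>linear A\<close> \<phi> C _ \<beta>] by blast
  next
    fix lam \<delta>x \<delta> x xh y \<xi>
    assume "\<gamma> < 1" "lam \<ge> \<beta>" and \<xi>: "\<xi> = y - A x"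
      and "\<exists>P\<in>sparse_projs wt s. group_norm N (group_map V x - P (group_map V x)) \<le> \<delta>x"
      "lam * \<phi> (A xh - y) + group_norm N (group_map V xh)
        \<le> (INF z. lam * \<phi> (A z - y) + group_norm N (group_map V z)) + \<delta>"
    then show "group_norm N (group_map V xh - group_map V x)
        \<le> (2 * \<delta>x + \<delta> + 2 * lam * \<phi> \<xi>) / (1 - \<gamma>)"
      unfolding \<xi> using cond_C_penalized_recovery[where V = V and N = N, OF N \<open>linear A\<close> \<phi> C _ \<beta>]
      by blast
  qed
qed

end
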